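(* Let $d \in \mathbb{N}$, let $r > 0$ be a real number, and let $\boldsymbol{x} = (x_1,\dots,x_d) \in [0,1]^d$ be such that $\|\boldsymbol{x}\|_1 = \sum_{i=1}^d |x_i| < 1$. Let $\boldsymbol{\eta} = (\eta_1,\dots,\eta_d) \sim \mathrm{Neg\,Multinomial}(r,\boldsymbol{x})$, and put $y_i = x_i/(1 - \|\boldsymbol{x}\|_1)$ for all $i \in \{1,\dots,d\}$. Then, for all $p_1,\dots,p_d \in \mathbb{N}_0$, $$\mathbb{E}\left[\prod_{i=1}^d (\eta_i - \mathbb{E}[\eta_i])^{p_i}\right] = \sum_{\ell_1=0}^{p_1} \cdots \sum_{\ell_d=0}^{p_d} \sum_{k_1=0}^{\ell_1} \cdots \sum_{k_d=0}^{\ell_d} \left(r - 1 + \|\boldsymbol{k}\|_1\right)^{(\|\boldsymbol{k}\|_1)} (-r)^{\sum_{i=1}^d (p_i - \ell_i)} \prod_{i=1}^d \binom{p_i}{\ell_i} \left\{ {\ell_i \atop k_i} \right\} y_i^{p_i - \ell_i + k_i},$$ where $\boldsymbol{k} = (k_1,\dots,k_d)$.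
   Context: Notation: $\mathbb{N} = \{1,2,\dots\}$, $\mathbb{N}_0 = \{0,1,2,\dots\}$, and $\|\boldsymbol{v}\|_1 = \sum_{i=1}^d |v_i|$ for $\boldsymbol{v} \in \mathbb{R}^d$. Negative multinomial distribution: for $d \in \mathbb{N}$, a real $r > 0$, and $\boldsymbol{x} \in [0,1]^d$ with $\|\boldsymbol{x}\|_1 < 1$, a random vector $\boldsymbol{\eta}$ with values in $\mathbb{N}_0^d$ satisfies $\boldsymbol{\eta} \sim \mathrm{Neg\,Multinomial}(r,\boldsymbol{x})$ if its probability mass function is $$P_{r,\boldsymbol{x}}(\boldsymbol{k}) = \frac{\Gamma(r + \|\boldsymbol{k}\|_1)}{\Gamma(r) \prod_{i=1}^d \Gamma(k_i + 1)} (1 - \|\boldsymbol{x}\|_1)^r \prod_{i=1}^d x_i^{k_i}, \qquad \boldsymbol{k} = (k_1,\dots,k_d) \in \mathbb{N}_0^d.$$ Falling factorial: for $m \in \mathbb{R}$ and $k \in \mathbb{N}_0$, $m^{(k)} = m(m-1)\cdots(m-k+1)$, with $m^{(0)} = 1$ (empty product). Binomial coefficient: $\binom{p}{\ell} = \frac{p!}{\ell!(p-\ell)!}$. Stirling number of the second kind: $\left\{ {p \atop k} \right\}$ is the number of ways to partition a set of $p$ objects into $k$ non-empty subsets (in particular $\left\{ {0 \atop 0} \right\} = 1$, and $\left\{ {p \atop 0} \right\} = 0$ for $p \geq 1$). The convention $0^0 = 1$ is used for powers with exponent zero. *)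

theory Defs
  imports "HOL-Probability.Probability" "HOL-Combinatorics.Stirling"
begin

definition l1norm :: "real ^ 'n::finite \<Rightarrow> real" where
  "l1norm v = (\<Sum>i\<in>UNIV. \<bar>v $ i\<bar>)"

text \<open>On vectors of natural numbers the 1-norm is kept in \<^typ>\<open>nat\<close>, because it also serves as
  the order of a falling factorial.\<close>

definition l1norm_nat :: "nat ^ 'n::finite \<Rightarrow> nat" where
  "l1norm_nat k = (\<Sum>i\<in>UNIV. k $ i)"

definition ffact :: "real \<Rightarrow> nat \<Rightarrow> real" where
  "ffact m k = (\<Prod>j<k. m - real j)"

text \<open>The box of multi-indices over which an iterated sum with componentwise bounds ranges.\<close>

definition box_upto :: "nat ^ 'n::finite \<Rightarrow> (nat ^ 'n) set" where
  "box_upto p = {l. \<forall>i. l $ i \<le> p $ i}"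

lemma finite_box_upto [simp]: "finite (box_upto p)"
proof (rule finite_subset)
  show "box_upto p \<subseteq> vec_lambda ` (\<Pi>\<^sub>E i\<in>UNIV. {..p $ i})"
  proof
    fix l assume "l \<in> box_upto p"
    then have "vec_nth l \<in> (\<Pi>\<^sub>E i\<in>UNIV. {..p $ i})"
      by (auto simp: box_upto_def)
    then show "l \<in> vec_lambda ` (\<Pi>\<^sub>E i\<in>UNIV. {..p $ i})"
      by (intro image_eqI[of _ _ "vec_nth l"]) (simp_all add: vec_nth_inverse)
  qed
  show "finite (vec_lambda ` (\<Pi>\<^sub>E i\<in>UNIV. {..p $ i}))"
    by (intro finite_imageI finite_PiE) auto
qed

definition neg_multinomial_mass :: "real \<Rightarrow> real ^ 'n::finite \<Rightarrow> nat ^ 'n \<Rightarrow> real" where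
  "neg_multinomial_mass r x k =
     Gamma (r + real (l1norm_nat k)) / (Gamma r * (\<Prod>i\<in>UNIV. Gamma (real (k $ i) + 1)))
       * (1 - l1norm x) powr r * (\<Prod>i\<in>UNIV. (x $ i) ^ (k $ i))"

text \<open>A density with respect to counting measure is a probability mass function.\<close>

definition neg_multinomial_distributed ::
    "'a measure \<Rightarrow> ('a \<Rightarrow> nat ^ 'n::finite) \<Rightarrow> real \<Rightarrow> real ^ 'n \<Rightarrow> bool" where
  "neg_multinomial_distributed M \<eta> r x \<longleftrightarrow>
     distributed M (count_space UNIV) \<eta> (\<lambda>k. ennreal (neg_multinomial_mass r x k))"

end

theory Submission
  imports Defs
begin

text \<open>
  The negative multinomial distribution is a Gamma mixture of Poisson laws: if \<open>T\<close> has a Gamma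
  distribution of shape \<open>r\<close> and rate \<open>1 - \<parallel>x\<parallel>\<close>, and the coordinates are, given \<open>T = t\<close>,
  independent Poisson variables with parameters \<open>t * x\<^sub>i\<close>, then the vector has mass function
  \<^const>\<open>neg_multinomial_mass\<close>. The factorial moments of a Poisson law are the powers of its
  parameter, so the mixed factorial moment of orders \<open>k\<close> is
  \<open>(\<Prod>i. x\<^sub>i ^ k\<^sub>i) * E [T ^ \<parallel>k\<parallel>]\<close>. A moment of a Gamma law is a quotient of Gamma values
  divided by a power of the rate,
  which gives \<open>ffact (r - 1 + \<parallel>k\<parallel>) \<parallel>k\<parallel> * (\<Prod>i. y\<^sub>i ^ k\<^sub>i)\<close>; the mean \<open>r * y\<^sub>i\<close> is
  the case where \<open>k\<close> is a unit vector.

  The mixture needs no random variable \<open>T\<close>: it amounts to writing the factor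
  \<open>Gamma (r + \<parallel>j\<parallel>)\<close> of the mass function as Euler's integral and exchanging the integral with
  the sum over \<open>j\<close>. All terms are nonnegative, so the exchange is free, and the finiteness of the
  result is also what shows that the moments exist
  (\<open>nn_integral_neg_multinomial_ffact\<close>, \<open>has_bochner_integral_neg_multinomial_ffact\<close>).

  The rest is algebra. In each coordinate, the centred power expands by the binomial theorem into
  powers of \<open>\<eta>\<^sub>i\<close>, and Stirling numbers of the second kind turn these into falling
  factorials (\<open>centred_power_eq_sum\<close>). Multiplying over the coordinates gives a finite
  linear combination of products of falling factorials, which is integrated term by term.
\<close>

section \<open>Falling factorials\<close>

lemma ffact_0 [simp]: "ffact x 0 = 1"
  by (simp add: ffact_def)

lemma ffact_Suc: "ffact x (Suc k) = ffact x k * (x - real k)"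
  by (simp add: ffact_def)

text \<open>The recursion of the Stirling numbers reflects the identity
  \<open>x * ffact x k = ffact x (k + 1) + k * ffact x k\<close>, by which a further factor \<open>x\<close> is
  absorbed.\<close>

lemma power_eq_sum_Stirling_ffact:
  "x ^ n = (\<Sum>k\<le>n. real (Stirling n k) * ffact x k)"
proof (induction n)
  case (Suc n)
  have "x ^ Suc n = (\<Sum>k\<le>n. real (Stirling n k) * (x * ffact x k))"
    by (simp add: Suc sum_distrib_left mult_ac)
  also have "\<dots> = (\<Sum>k\<le>n. real (k * Stirling n k) * ffact x k)
      + (\<Sum>k\<le>n. real (Stirling n k) * ffact x (Suc k))"
    unfolding sum.distrib [symmetric]
    by (rule sum.cong) (simp_all add: ffact_Suc algebra_simps)
  also have "(\<Sum>k\<le>n. real (k * Stirling n k) * ffact x k)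
      = (\<Sum>k\<le>Suc n. real (k * Stirling n k) * ffact x k)"
    by simp
  also have "\<dots> = (\<Sum>k\<le>n. real (Suc k * Stirling n (Suc k)) * ffact x (Suc k))"
    by (subst sum.atMost_Suc_shift) simp
  also have "(\<Sum>k\<le>n. real (Suc k * Stirling n (Suc k)) * ffact x (Suc k))
      + (\<Sum>k\<le>n. real (Stirling n k) * ffact x (Suc k))
      = (\<Sum>k\<le>n. real (Stirling (Suc n) (Suc k)) * ffact x (Suc k))"
    unfolding sum.distrib [symmetric]
    by (rule sum.cong) (simp_all add: algebra_simps)
  also have "\<dots> = (\<Sum>k\<le>Suc n. real (Stirling (Suc n) k) * ffact x k)"
    by (simp add: sum.atMost_Suc_shift del: sum.atMost_Suc Stirling.simps(4))
  finally show ?case .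
qed simp

lemma ffact_of_nat_eq_0: "m < k \<Longrightarrow> ffact (real m) k = 0"
  by (auto simp: ffact_def)

lemma ffact_of_nat: "k \<le> m \<Longrightarrow> ffact (real m) k = fact m / fact (m - k)"
proof (induction k)
  case (Suc k)
  then have *: "m - k = Suc (m - Suc k)" by simp
  have "(fact (m - k) :: real) = (real m - real k) * fact (m - Suc k)"
    using Suc.prems by (subst *) (simp add: of_nat_diff algebra_simps)
  with Suc show ?case by (simp add: ffact_Suc)
qed simp

lemma ffact_of_nat_nonneg: "0 \<le> ffact (real m) k"
  by (cases "m < k") (simp_all add: ffact_of_nat_eq_0 ffact_of_nat)

text \<open>Read from its last factor upwards, this falling factorial is the rising product
  \<open>r * (r + 1) * \<dots> * (r + n - 1)\<close>; that is where the shift by \<open>r - 1\<close> in the moment formula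
  comes from.\<close>

lemma ffact_eq_Gamma_ratio:
  assumes "r > 0"
  shows "ffact (r - 1 + real n) n = Gamma (r + real n) / Gamma r"
proof -
  have "ffact (r - 1 + real n) n = (\<Prod>j<n. r + real (n - Suc j))"
    unfolding ffact_def by (rule prod.cong) (auto simp: of_nat_diff)
  also have "\<dots> = (\<Prod>j<n. r + real j)"
    by (rule prod.nat_diff_reindex)
  also have "\<dots> = pochhammer r n"
    by (simp add: pochhammer_prod atLeast0LessThan)
  also have "\<dots> = Gamma (r + real n) / Gamma r"
    using assms by (intro pochhammer_Gamma) (auto elim!: nonpos_Ints_cases)
  finally show ?thesis .
qed

section \<open>Poisson sums and Gamma integrals\<close>

text \<open>Up to the factor \<open>exp (- u)\<close>, this is the factorial moment of order \<open>k\<close> of the Poisson law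
  with parameter \<open>u\<close>. The first \<open>k\<close> terms vanish, and the others form a shifted exponential
  series.\<close>

lemma sums_ffact_power_div_fact:
  "(\<lambda>j. ffact (real j) k * u ^ j / fact j) sums (u ^ k * exp u)"
proof -
  have "(\<lambda>j. u ^ k * (u ^ j / fact j)) sums (u ^ k * exp u)"
    using exp_converges [of u] by (intro sums_mult) (simp add: field_simps scaleR_conv_of_real)
  also have "(\<lambda>j. u ^ k * (u ^ j / fact j)) =
      (\<lambda>j. ffact (real (j + k)) k * u ^ (j + k) / fact (j + k))"
    by (subst ffact_of_nat) (auto simp: power_add)
  finally show ?thesis
    by (subst (asm) sums_iff_shift) (simp add: ffact_of_nat_eq_0)
qed

lemma nn_integral_ffact_power_div_fact:
  assumes "u \<ge> 0"
  shows "(\<integral>\<^sup>+ j. ennreal (ffact (real j) k * u ^ j / fact j) \<partial>count_space UNIV)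
    = ennreal (u ^ k * exp u)"
  using sums_ffact_power_div_fact [of k u] assms ffact_of_nat_nonneg
  by (simp add: nn_integral_count_space_nat suminf_ennreal_eq sums_iff)

text \<open>Tonelli's theorem for sums over \<open>\<nat>\<^sup>n\<close>: counting measure on a finite power of a countable
  set is the product of counting measures.\<close>

lemma nn_integral_vec_prod:
  fixes f :: "'n::finite \<Rightarrow> nat \<Rightarrow> ennreal"
  shows "(\<integral>\<^sup>+ j. (\<Prod>i\<in>UNIV. f i (j $ i)) \<partial>count_space (UNIV :: (nat ^ 'n) set))
    = (\<Prod>i\<in>UNIV. \<integral>\<^sup>+ m. f i m \<partial>count_space UNIV)"
proof -
  have bij: "bij_betw vec_lambda (UNIV :: ('n \<Rightarrow> nat) set) UNIV"
    by (rule bij_betwI [of _ _ _ vec_nth]) (auto simp: vec_nth_inverse)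
  interpret product_sigma_finite "\<lambda>_::'n. count_space (UNIV :: nat set)"
    by (intro product_sigma_finite.intro sigma_finite_measure_count_space)
  have PiM: "PiM UNIV (\<lambda>_::'n. count_space (UNIV :: nat set)) = count_space UNIV"
    using count_space_PiM_finite [of "UNIV :: 'n set" "\<lambda>_. UNIV :: nat set"] by simp
  show ?thesis
    unfolding nn_integral_bij_count_space [OF bij, symmetric]
    using product_nn_integral_prod [of UNIV f] by (simp add: PiM)
qed

text \<open>Euler's integral after the substitution of \<open>b * t\<close> for the variable: the
  normalisation of the Gamma density with shape \<open>a\<close> and rate \<open>b\<close>.\<close>

lemma nn_integral_Gamma_scaled:
  fixes a b :: real
  assumes "a > 0" "b > 0"
  shows "(\<integral>\<^sup>+ t. ennreal (indicator {0..} t * t powr (a - 1) * exp (- (b * t))) \<partial>lborel)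
    = ennreal (Gamma a * b powr (- a))"
proof -
  let ?I = "\<integral>\<^sup>+ t. ennreal (indicator {0..} t * t powr (a - 1) * exp (- (b * t))) \<partial>lborel"
  have "ennreal (Gamma a) =
      ennreal b * (\<integral>\<^sup>+ t. ennreal (indicator {0..} (b * t) * (b * t) powr (a - 1) / exp (b * t)) \<partial>lborel)"
    using assms nn_integral_real_affine
      [of "\<lambda>t. ennreal (indicator {0..} t * t powr (a - 1) / exp t)" b 0]
    by (simp add: Gamma_conv_nn_integral_real)
  also have "(\<integral>\<^sup>+ t. ennreal (indicator {0..} (b * t) * (b * t) powr (a - 1) / exp (b * t)) \<partial>lborel)
      = (\<integral>\<^sup>+ t. ennreal (b powr (a - 1)) *
          ennreal (indicator {0..} t * t powr (a - 1) * exp (- (b * t))) \<partial>lborel)"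
    using assms
    by (intro nn_integral_cong)
      (auto simp: indicator_def ennreal_mult' [symmetric] powr_mult exp_minus field_simps
        zero_le_mult_iff)
  also have "\<dots> = ennreal (b powr (a - 1)) * ?I"
    by (rule nn_integral_cmult) measurable
  finally have *: "ennreal (Gamma a) = ennreal b * (ennreal (b powr (a - 1)) * ?I)" .
  have "ennreal b * ennreal (b powr (a - 1)) = ennreal (b powr a)"
    using assms by (simp add: ennreal_mult' [symmetric] powr_diff)
  with * have "ennreal (Gamma a) = ennreal (b powr a) * ?I"
    by (simp add: mult.assoc [symmetric])
  then have "ennreal (b powr (- a)) * ennreal (Gamma a) = ennreal (b powr (- a)) * ennreal (b powr a) * ?I"
    by (simp add: mult.assoc)
  also have "ennreal (b powr (- a)) * ennreal (b powr a) = 1"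
    using assms by (simp add: ennreal_mult' [symmetric] powr_minus)
  finally show ?thesis
    using assms by (simp add: ennreal_mult' mult.commute)
qed

section \<open>Factorial moments of the negative multinomial distribution\<close>

text \<open>The Poisson mixture computation. After \<open>Gamma (r + \<parallel>j\<parallel>)\<close> is written as an integral over
  \<open>t\<close>, the factor \<open>t ^ \<parallel>j\<parallel>\<close> distributes over the coordinates and the sum over \<open>j\<close> factorises
  into one Poisson sum per coordinate. Those sums contribute \<open>exp (t * \<parallel>x\<parallel>)\<close>, which lowers the
  rate of the Gamma integral from \<open>1\<close> to \<open>1 - \<parallel>x\<parallel>\<close>; this is how \<open>x\<^sub>i\<close> becomes
  \<open>x\<^sub>i / (1 - \<parallel>x\<parallel>)\<close>.\<close>

lemma nn_integral_neg_multinomial_ffact: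
  fixes x :: "real ^ 'n::finite" and k :: "nat ^ 'n"
  assumes r: "r > 0" and x: "\<And>i. 0 \<le> x $ i" and s: "l1norm x < 1"
  shows "(\<integral>\<^sup>+ j. ennreal (neg_multinomial_mass r x j * (\<Prod>i\<in>UNIV. ffact (real (j $ i)) (k $ i)))
        \<partial>count_space UNIV)
    = ennreal (ffact (r - 1 + real (l1norm_nat k)) (l1norm_nat k)
        * (\<Prod>i\<in>UNIV. (x $ i / (1 - l1norm x)) ^ (k $ i)))"
proof -
  define b where "b = 1 - l1norm x"
  have b: "b > 0" using s by (simp add: b_def)
  \<comment> \<open>\<open>c * w t\<close> is the Gamma density of rate \<open>b\<close> times \<open>exp (- (t * l1norm x))\<close>; that exponential
      normalises the Poisson weights, so \<open>g t i m\<close> is left without one.\<close>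
  define c where "c = b powr r / Gamma r"
  have c: "c \<ge> 0" using r by (simp add: c_def)
  define w where "w t = indicator {0..} t * t powr (r - 1) * exp (- t)" for t :: real
  have w: "w t \<ge> 0" for t by (simp add: w_def)
  have [measurable]: "w \<in> borel_measurable borel" unfolding w_def by measurable
  define g where "g t i m = ffact (real m) (k $ i) * (t * x $ i) ^ m / fact m" for t i m
  have g: "g t i m \<ge> 0" if "t \<ge> 0" for t i m
    using that x ffact_of_nat_nonneg by (simp add: g_def)
  have mass: "ennreal (neg_multinomial_mass r x j * (\<Prod>i\<in>UNIV. ffact (real (j $ i)) (k $ i)))
      = (\<integral>\<^sup>+ t. ennreal (c * w t) * (\<Prod>i\<in>UNIV. ennreal (g t i (j $ i))) \<partial>lborel)" for j
  proof -
    define A where "A = (\<Prod>i\<in>UNIV. ffact (real (j $ i)) (k $ i) * (x $ i) ^ (j $ i) / fact (j $ i))"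
    have A: "A \<ge> 0"
      unfolding A_def using x ffact_of_nat_nonneg by (intro prod_nonneg) auto
    have "neg_multinomial_mass r x j * (\<Prod>i\<in>UNIV. ffact (real (j $ i)) (k $ i))
        = c * A * Gamma (r + real (l1norm_nat j))"
      by (simp add: neg_multinomial_mass_def A_def c_def b_def prod.distrib prod_dividef
          add.commute [of _ 1] Gamma_fact)
    also have "ennreal \<dots> = ennreal (c * A) * ennreal (Gamma (r + real (l1norm_nat j)))"
      using c A by (simp add: ennreal_mult')
    also have "\<dots> = (\<integral>\<^sup>+ t. ennreal (c * A) * ennreal (indicator {0..} t *
        t powr (r + real (l1norm_nat j) - 1) / exp t) \<partial>lborel)"
      using r by (subst Gamma_conv_nn_integral_real) (simp_all add: nn_integral_cmult)
    also have "\<dots> = (\<integral>\<^sup>+ t. ennreal (c * w t) * (\<Prod>i\<in>UNIV. ennreal (g t i (j $ i))) \<partial>lborel)"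
    proof (rule nn_integral_cong)
      fix t :: real
      \<comment> \<open>At \<open>t = 0\<close> both sides vanish because \<open>0 powr a = 0\<close> for every \<open>a\<close>.\<close>
      consider "t < 0" | "t = 0" | "t > 0" by linarith
      then show "ennreal (c * A) * ennreal (indicator {0..} t *
          t powr (r + real (l1norm_nat j) - 1) / exp t)
          = ennreal (c * w t) * (\<Prod>i\<in>UNIV. ennreal (g t i (j $ i)))"
      proof cases
        assume t: "t > 0"
        have "(\<Prod>i\<in>UNIV. g t i (j $ i)) = A * (\<Prod>i\<in>UNIV. t ^ (j $ i))"
          by (simp add: g_def A_def power_mult_distrib prod.distrib prod_dividef)
        also have "(\<Prod>i\<in>UNIV. t ^ (j $ i)) = t powr real (l1norm_nat j)"
          using t by (simp add: l1norm_nat_def power_sum powr_realpow del: of_nat_sum)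
        finally have "c * w t * (\<Prod>i\<in>UNIV. g t i (j $ i))
            = c * A * (indicator {0..} t * t powr (r + real (l1norm_nat j) - 1) / exp t)"
          using t by (simp add: w_def exp_minus powr_add powr_diff field_simps)
        moreover have "(\<Prod>i\<in>UNIV. ennreal (g t i (j $ i))) = ennreal (\<Prod>i\<in>UNIV. g t i (j $ i))"
          using t g by (intro prod_ennreal) auto
        ultimately show ?thesis
          using c A w t by (simp add: ennreal_mult' [symmetric] prod_nonneg g)
      qed (simp_all add: w_def)
    qed
    finally show ?thesis .
  qed
  have "(\<integral>\<^sup>+ j. ennreal (neg_multinomial_mass r x j * (\<Prod>i\<in>UNIV. ffact (real (j $ i)) (k $ i)))
        \<partial>count_space UNIV)
      = (\<integral>\<^sup>+ t. \<integral>\<^sup>+ j. ennreal (c * w t) * (\<Prod>i\<in>UNIV. ennreal (g t i (j $ i)))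
          \<partial>count_space UNIV \<partial>lborel)"
    unfolding mass g_def by (rule nn_integral_count_space_nn_integral [symmetric]) measurable
  also have "\<dots> = (\<integral>\<^sup>+ t. ennreal (c * w t) *
      (\<Prod>i\<in>UNIV. \<integral>\<^sup>+ m. ennreal (g t i m) \<partial>count_space UNIV) \<partial>lborel)"
    by (simp add: nn_integral_cmult nn_integral_vec_prod [of "\<lambda>i m. ennreal (g t i m)" for t])
  also have "\<dots> = (\<integral>\<^sup>+ t. ennreal (c * (\<Prod>i\<in>UNIV. (x $ i) ^ (k $ i))) *
      ennreal (indicator {0..} t * t powr (r + real (l1norm_nat k) - 1) * exp (- (b * t))) \<partial>lborel)"
  proof (rule nn_integral_cong)
    fix t :: real
    consider "t < 0" | "t = 0" | "t > 0" by linarith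
    then show "ennreal (c * w t) * (\<Prod>i\<in>UNIV. \<integral>\<^sup>+ m. ennreal (g t i m) \<partial>count_space UNIV)
        = ennreal (c * (\<Prod>i\<in>UNIV. (x $ i) ^ (k $ i))) *
      ennreal (indicator {0..} t * t powr (r + real (l1norm_nat k) - 1) * exp (- (b * t)))"
    proof cases
      assume t: "t > 0"
      have "(\<Prod>i\<in>UNIV. \<integral>\<^sup>+ m. ennreal (g t i m) \<partial>count_space UNIV)
          = (\<Prod>i\<in>UNIV. ennreal ((t * x $ i) ^ (k $ i) * exp (t * x $ i)))"
        unfolding g_def using t x by (simp add: nn_integral_ffact_power_div_fact)
      also have "\<dots> = ennreal (\<Prod>i\<in>UNIV. (t * x $ i) ^ (k $ i) * exp (t * x $ i))"
        using t x by (intro prod_ennreal) simp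
      also have "(\<Prod>i\<in>UNIV. (t * x $ i) ^ (k $ i) * exp (t * x $ i))
          = (\<Prod>i\<in>UNIV. t ^ (k $ i)) * (\<Prod>i\<in>UNIV. (x $ i) ^ (k $ i)) * exp (t * l1norm x)"
        using x by (simp add: power_mult_distrib prod.distrib exp_sum l1norm_def sum_distrib_left)
      also have "(\<Prod>i\<in>UNIV. t ^ (k $ i)) = t powr real (l1norm_nat k)"
        using t by (simp add: l1norm_nat_def power_sum powr_realpow del: of_nat_sum)
      finally have "(\<Prod>i\<in>UNIV. \<integral>\<^sup>+ m. ennreal (g t i m) \<partial>count_space UNIV) = ennreal
          (t powr real (l1norm_nat k) * (\<Prod>i\<in>UNIV. (x $ i) ^ (k $ i)) * exp (t * l1norm x))" .
      moreover have "exp (- (b * t)) = exp (- t) * exp (t * l1norm x)"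
        by (simp add: b_def exp_add [symmetric] algebra_simps)
      ultimately show ?thesis
        using c w t x
        by (simp add: ennreal_mult' [symmetric] prod_nonneg)
          (simp add: w_def powr_add powr_diff field_simps)
    qed (simp_all add: w_def)
  qed
  also have "\<dots> = ennreal (c * (\<Prod>i\<in>UNIV. (x $ i) ^ (k $ i))) *
      ennreal (Gamma (r + real (l1norm_nat k)) * b powr (- (r + real (l1norm_nat k))))"
    using r b by (subst nn_integral_cmult) (simp_all add: nn_integral_Gamma_scaled)
  also have "\<dots> = ennreal (c * (\<Prod>i\<in>UNIV. (x $ i) ^ (k $ i)) *
      (Gamma (r + real (l1norm_nat k)) * b powr (- (r + real (l1norm_nat k)))))"
    using c x by (intro ennreal_mult' [symmetric] mult_nonneg_nonneg prod_nonneg) auto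
  also have "c * (\<Prod>i\<in>UNIV. (x $ i) ^ (k $ i)) *
      (Gamma (r + real (l1norm_nat k)) * b powr (- (r + real (l1norm_nat k))))
      = ffact (r - 1 + real (l1norm_nat k)) (l1norm_nat k)
        * ((\<Prod>i\<in>UNIV. (x $ i) ^ (k $ i)) / b ^ l1norm_nat k)"
  proof -
    have b_powr: "b powr (- (r + real (l1norm_nat k))) = 1 / (b powr r * b ^ l1norm_nat k)"
      using b by (simp only: powr_minus powr_add powr_realpow inverse_eq_divide)
    show ?thesis
      using r b unfolding ffact_eq_Gamma_ratio [OF r] c_def b_powr by (simp add: field_simps)
  qed
  also have "(\<Prod>i\<in>UNIV. (x $ i) ^ (k $ i)) / b ^ l1norm_nat k = (\<Prod>i\<in>UNIV. (x $ i / b) ^ (k $ i))"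
    by (simp add: l1norm_nat_def power_sum power_divide prod_dividef)
  finally show ?thesis by (simp add: b_def)
qed

lemma neg_multinomial_mass_nonneg:
  assumes "r > 0" "\<And>i. 0 \<le> x $ i"
  shows "0 \<le> neg_multinomial_mass r x k"
  unfolding neg_multinomial_mass_def using assms
  by (intro mult_nonneg_nonneg divide_nonneg_nonneg prod_nonneg) (auto intro!: Gamma_real_nonneg)

text \<open>A falling factorial of a natural number is nonnegative, so the value of its
  nonnegative integral already contains its integrability. Only the centring brings in
  signs, and it is a finite linear combination.\<close>

lemma has_bochner_integral_neg_multinomial_ffact:
  fixes M :: "'a measure" and \<eta> :: "'a \<Rightarrow> nat ^ 'n::finite"
  assumes r: "r > 0" and x: "\<And>i. 0 \<le> x $ i" and s: "l1norm x < 1"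
    and \<eta>: "neg_multinomial_distributed M \<eta> r x"
  shows "has_bochner_integral M (\<lambda>\<omega>. \<Prod>i\<in>UNIV. ffact (real (\<eta> \<omega> $ i)) (k $ i))
    (ffact (r - 1 + real (l1norm_nat k)) (l1norm_nat k)
        * (\<Prod>i\<in>UNIV. (x $ i / (1 - l1norm x)) ^ (k $ i)))"
    (is "has_bochner_integral M _ ?m")
proof -
  let ?F = "\<lambda>j :: nat ^ 'n. \<Prod>i\<in>UNIV. ffact (real (j $ i)) (k $ i)"
  have dist: "distributed M (count_space UNIV) \<eta> (\<lambda>j. ennreal (neg_multinomial_mass r x j))"
    using \<eta> by (simp add: neg_multinomial_distributed_def)
  have F: "?F j \<ge> 0" for j
    by (intro prod_nonneg ballI ffact_of_nat_nonneg)
  have "Gamma (r + real (l1norm_nat k)) / Gamma r \<ge> 0"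
    using r by simp
  then have m: "?m \<ge> 0"
    unfolding ffact_eq_Gamma_ratio [OF r] using x s
    by (intro mult_nonneg_nonneg prod_nonneg) auto
  have "(\<integral>\<^sup>+ \<omega>. ennreal (?F (\<eta> \<omega>)) \<partial>M)
      = (\<integral>\<^sup>+ j. ennreal (neg_multinomial_mass r x j) * ennreal (?F j) \<partial>count_space UNIV)"
    by (rule distributed_nn_integral [OF dist, symmetric]) simp
  also have "\<dots> = (\<integral>\<^sup>+ j. ennreal (neg_multinomial_mass r x j * ?F j) \<partial>count_space UNIV)"
    by (simp add: ennreal_mult' neg_multinomial_mass_nonneg [OF r x])
  also have "\<dots> = ennreal ?m"
    by (rule nn_integral_neg_multinomial_ffact [OF r x s])
  finally have "(\<integral>\<^sup>+ \<omega>. ennreal (?F (\<eta> \<omega>)) \<partial>M) = ennreal ?m" .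
  moreover have "(\<lambda>\<omega>. ?F (\<eta> \<omega>)) \<in> borel_measurable M"
    using distributed_measurable [OF dist] by (rule measurable_compose) simp
  ultimately show ?thesis
    using F m by (intro has_bochner_integral_nn_integral) auto
qed

lemma neg_multinomial_expectation:
  fixes M :: "'a measure" and \<eta> :: "'a \<Rightarrow> nat ^ 'n::finite"
  assumes r: "r > 0" and x: "\<And>i. 0 \<le> x $ i" and s: "l1norm x < 1"
    and \<eta>: "neg_multinomial_distributed M \<eta> r x"
  shows "(\<integral>\<omega>. real (\<eta> \<omega> $ i) \<partial>M) = r * (x $ i / (1 - l1norm x))"
proof -
  define e :: "nat ^ 'n" where "e = (\<chi> h. if h = i then 1 else 0)"
  have [simp]: "l1norm_nat e = 1"
    by (simp add: l1norm_nat_def e_def)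
  have single: "(\<Prod>h\<in>UNIV. if h = i then a h else 1) = a i" for a :: "'n \<Rightarrow> real"
    by simp
  have 1: "(\<Prod>h\<in>UNIV. ffact (real (v $ h)) (e $ h)) = real (v $ i)" for v :: "nat ^ 'n"
    using single [of "\<lambda>h. real (v $ h)"]
    by (simp add: e_def ffact_Suc if_distrib [of "ffact _"] cong: if_cong)
  have 2: "(\<Prod>h\<in>UNIV. a h ^ (e $ h)) = a i" for a :: "'n \<Rightarrow> real"
    using single [of a]
    by (simp add: e_def if_distrib [of "power _"] cong: if_cong)
  show ?thesis
    using has_bochner_integral_neg_multinomial_ffact [OF r x s \<eta>, of e]
    by (intro has_bochner_integral_integral_eq) (simp add: 1 2 ffact_Suc)
qed

section \<open>Central moments\<close>

lemma prod_sum_atMost_eq_sum_box_upto: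
  fixes f :: "'n::finite \<Rightarrow> nat \<Rightarrow> 'b::comm_semiring_1"
  shows "(\<Prod>i\<in>UNIV. \<Sum>m\<le>p $ i. f i m) = (\<Sum>l\<in>box_upto p. \<Prod>i\<in>UNIV. f i (l $ i))"
proof -
  have "(\<Prod>i\<in>UNIV. \<Sum>m\<le>p $ i. f i m) = (\<Sum>h\<in>(\<Pi>\<^sub>E i\<in>UNIV. {..p $ i}). \<Prod>i\<in>UNIV. f i (h i))"
    by (rule prod_sum_PiE) auto
  also have "\<dots> = (\<Sum>l\<in>box_upto p. \<Prod>i\<in>UNIV. f i (l $ i))"
    by (rule sum.reindex_bij_witness [of _ vec_nth vec_lambda])
      (auto simp: box_upto_def vec_nth_inverse)
  finally show ?thesis .
qed

lemma centred_power_eq_sum: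
  "(z - r * y) ^ p = (\<Sum>l\<le>p. \<Sum>k\<le>l. real (p choose l) * real (Stirling l k)
      * (- r) ^ (p - l) * y ^ (p - l) * ffact z k)"
proof -
  have "(z - r * y) ^ p = (z + (- r) * y) ^ p"
    by simp
  also have "\<dots> = (\<Sum>l\<le>p. real (p choose l) * z ^ l * ((- r) ^ (p - l) * y ^ (p - l)))"
    by (simp only: binomial_ring power_mult_distrib)
  also have "\<dots> = (\<Sum>l\<le>p. \<Sum>k\<le>l. real (p choose l) * real (Stirling l k)
      * (- r) ^ (p - l) * y ^ (p - l) * ffact z k)"
    unfolding power_eq_sum_Stirling_ffact [of z]
    by (simp only: sum_distrib_left sum_distrib_right mult_ac)
  finally show ?thesis .
qed

theorem theorem2:
  fixes M :: "'a measure" and \<eta> :: "'a \<Rightarrow> nat ^ 'n::finite"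
    and r :: real and x y :: "real ^ 'n" and p :: "nat ^ 'n"
  assumes "prob_space M"
    and "r > 0"
    and "\<And>i. 0 \<le> x $ i \<and> x $ i \<le> 1"
    and "l1norm x < 1"
    and "neg_multinomial_distributed M \<eta> r x"
    and "\<And>i. y $ i = x $ i / (1 - l1norm x)"
  shows "integrable M (\<lambda>\<omega>. \<Prod>i\<in>UNIV.
             (real (\<eta> \<omega> $ i) - prob_space.expectation M (\<lambda>\<omega>'. real (\<eta> \<omega>' $ i))) ^ (p $ i)) \<and>
         prob_space.expectation M (\<lambda>\<omega>. \<Prod>i\<in>UNIV.
             (real (\<eta> \<omega> $ i) - prob_space.expectation M (\<lambda>\<omega>'. real (\<eta> \<omega>' $ i))) ^ (p $ i)) =
         (\<Sum>l\<in>box_upto p. \<Sum>k\<in>box_upto l.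
             ffact (r - 1 + real (l1norm_nat k)) (l1norm_nat k)
             * (- r) ^ (\<Sum>i\<in>UNIV. p $ i - l $ i)
             * (\<Prod>i\<in>UNIV. real ((p $ i) choose (l $ i)) * real (Stirling (l $ i) (k $ i))
                             * (y $ i) ^ (p $ i - l $ i + k $ i)))"
proof -
  have x: "\<And>i. 0 \<le> x $ i" using assms(3) by blast
  note hyps = \<open>r > 0\<close> x \<open>l1norm x < 1\<close> \<open>neg_multinomial_distributed M \<eta> r x\<close>
  \<comment> \<open>The coefficient of the falling factorials of orders \<open>k\<close> in the expansion of the centred
      product, when \<open>l\<close> indexes the binomial terms.\<close>
  define C where "C l k = (\<Prod>i\<in>UNIV. real ((p $ i) choose (l $ i)) * real (Stirling (l $ i) (k $ i))
      * (- r) ^ (p $ i - l $ i) * (y $ i) ^ (p $ i - l $ i))" for l k :: "nat ^ 'n"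
  have E: "prob_space.expectation M (\<lambda>\<omega>. real (\<eta> \<omega> $ i)) = r * y $ i" for i
    using neg_multinomial_expectation [OF hyps] assms(6) by simp
  have "(\<Prod>i\<in>UNIV. (real (v $ i) - r * y $ i) ^ (p $ i))
      = (\<Sum>l\<in>box_upto p. \<Sum>k\<in>box_upto l. C l k * (\<Prod>i\<in>UNIV. ffact (real (v $ i)) (k $ i)))"
    for v :: "nat ^ 'n"
    by (simp add: centred_power_eq_sum prod_sum_atMost_eq_sum_box_upto C_def prod.distrib)
  moreover have "has_bochner_integral M
      (\<lambda>\<omega>. \<Sum>l\<in>box_upto p. \<Sum>k\<in>box_upto l. C l k * (\<Prod>i\<in>UNIV. ffact (real (\<eta> \<omega> $ i)) (k $ i)))
      (\<Sum>l\<in>box_upto p. \<Sum>k\<in>box_upto l. C l k *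
        (ffact (r - 1 + real (l1norm_nat k)) (l1norm_nat k) * (\<Prod>i\<in>UNIV. (y $ i) ^ (k $ i))))"
    unfolding assms(6)
    by (intro has_bochner_integral_sum has_bochner_integral_mult_right
        has_bochner_integral_neg_multinomial_ffact [OF hyps])
  moreover have "C l k * (ffact a n * (\<Prod>i\<in>UNIV. (y $ i) ^ (k $ i)))
      = ffact a n * (- r) ^ (\<Sum>i\<in>UNIV. p $ i - l $ i)
        * (\<Prod>i\<in>UNIV. real ((p $ i) choose (l $ i)) * real (Stirling (l $ i) (k $ i))
            * (y $ i) ^ (p $ i - l $ i + k $ i))" for l k a n
    by (simp add: C_def prod.distrib power_add power_sum mult_ac)
  ultimately show ?thesis
    unfolding E has_bochner_integral_iff [symmetric] by simp
qed

end
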